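(* Let $\mu_1,\mu_2$ be two LJSDs with the same marginal distribution of $\lambda$. In the ridgeless limit $\gamma\to0$ and in the overparameterized regime $\psi<\phi$, $E_{\mu_2}$ is linear in $E_{\mu_1}$, parametrically in $\phi/\psi$ (with $\phi$ fixed): for all $\psi\in(0,\phi)$, $$E_{\mu_2}=E_0+\mathrm{SLOPE}\cdot E_{\mu_1},\qquad \mathrm{SLOPE}=\frac{\xi_2^2}{\xi_1^2}\left(\frac{\omega_2+(\mathcal{I}^*_{1,1})_2}{\omega_1+(\mathcal{I}^*_{1,1})_1}\right),$$ where $E_0$ and $\mathrm{SLOPE}\ge0$ are constants independent of the overparameterization ratio $\phi/\psi$. Moreover, if $\mu_1\le\mu_2$ and $1\le\zeta_2/\zeta_1\le\eta_2/\eta_1$, then $\mathrm{SLOPE}\ge1$.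
   Context: Parameters: $\phi>0$, $0<\psi<\phi$, label noise $\sigma_\varepsilon^2\ge0$. Activation $\sigma:\mathbb{R}\to\mathbb{R}$, differentiable almost everywhere with $|\sigma(u)|,|\sigma'(u)|\le c_0e^{c_1|u|}$. LJSD: a limiting joint spectral distribution is a probability measure $\mu$ on $\mathbb{R}_+^2$, the law of a pair $(\lambda,r)$ (training eigenvalue, overlap coefficient of the test covariance), supported in $[0,C]^2$ for some $C$, either absolutely continuous or a finite sum of delta masses; $\mathbb{E}_\mu[\lambda],\mathbb{E}_\mu[r]$ are finite and positive. The marginal of $\lambda$ is $\mu_{\text{train}}$. Order: for LJSDs $\mu_1,\mu_2$ with the same marginal of $\lambda$, $\mu_1\le\mu_2$ means that $\mathbb{E}_{\mu_1}[r|\lambda]/\mathbb{E}_{\mu_2}[r|\lambda]$ is nondecreasing in $\lambda$ on the support of $\mu_{\text{train}}$ and $\mathbb{E}_{\mu_1}[r]\le\mathbb{E}_{\mu_2}[r]$. Constants: for a scale $t>0$ and $z\sim\mathcal N(0,t)$ put $\Omega_\sigma(t)=(\eta,\rho,\zeta,\omega)$ with $\eta=\mathbb{V}[\sigma(z)]$, $\rho=(\frac1t\mathbb{E}[z\sigma(z)])^2$, $\zeta=t\rho$, $\omega=t(\eta/\zeta-1)$ (assumed well defined). With $s=\mathbb{E}[\lambda]$: $(\eta,\rho,\zeta,\omega)=\Omega_\sigma(s)$. For an LJSD $\mu$ with $s_*=\mathbb{E}_\mu[r]$: $(\eta_*,\rho_*,\zeta_*,\omega_* )=\Omega_\sigma(s_*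 )$, $\xi=\sqrt{\rho_*/\rho}$. For $\mu_i$: $s_i=\mathbb{E}_{\mu_i}[r]$, $(\eta_i,\rho_i,\zeta_i,\omega_i)=\Omega_\sigma(s_i)$, $\xi_i=\sqrt{\rho_i/\rho}$. Functionals: $\mathcal{I}_{a,b}(x)=\phi\,\mathbb{E}_\mu[\lambda^a(\phi+x\lambda)^{-b}]$, $\mathcal{I}^*_{a,b}(x)=\phi\,\mathbb{E}_\mu[r\lambda^{a-1}(\phi+x\lambda)^{-b}]$; $(\mathcal{I}^*_{a,b})_i$ denotes $\mathcal{I}^*_{a,b}$ for $\mu=\mu_i$. Ridgeless limiting test error for $\psi<\phi$: with $x$ the unique positive real root of $x=1/(\omega+\mathcal{I}_{1,1}(x))$ and all functionals (including those in SLOPE) evaluated at $x$, $E_\mu=B_\mu+V_\mu$, $B_\mu=(1-\xi)^2s_*+2(1-\xi)\xi\mathcal{I}^*_{1,1}+\xi^2\phi\mathcal{I}^*_{1,2}$, $V_\mu=\xi^2\frac{\psi}{\phi-\psi}x(\sigma_\varepsilon^2+\mathcal{I}_{1,1})(\omega_*+\mathcal{I}^*_{1,1})+\xi^2x\Big(1-\frac{x(\omega-\sigma_\varepsilon^2)}{1-x^2\mathcal{I}_{2,2}}\Big)\mathcal{I}^*_{2,2}$. *)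

theory Defs
  imports "HOL-Probability.Probability"
begin

section \<open>Limiting joint spectral distributions\<close>

text \<open>A point of the plane is a pair \<open>(l, r)\<close>: \<open>l\<close> is the training eigenvalue and \<open>r\<close> the
  overlap coefficient.\<close>

definition finite_delta_sum :: "(real \<times> real) measure \<Rightarrow> bool" where
  "finite_delta_sum \<mu> \<longleftrightarrow>
     (\<exists>A w. finite A \<and> (\<forall>p\<in>A. 0 \<le> w p) \<and>
        (\<forall>B\<in>sets borel. measure \<mu> B = (\<Sum>p\<in>A. w p * indicator B p)))"

definition ljsd :: "(real \<times> real) measure \<Rightarrow> bool" where
  "ljsd \<mu> \<longleftrightarrow>
     prob_space \<mu> \<and> sets \<mu> = sets borel \<and>
     (\<exists>C. AE p in \<mu>. p \<in> {0..C} \<times> {0..C}) \<and>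
     (absolutely_continuous lborel \<mu> \<or> finite_delta_sum \<mu>) \<and>
     integrable \<mu> fst \<and> 0 < (\<integral>p. fst p \<partial>\<mu>) \<and>
     integrable \<mu> snd \<and> 0 < (\<integral>p. snd p \<partial>\<mu>)"

definition train_marginal :: "(real \<times> real) measure \<Rightarrow> real measure" where
  "train_marginal \<mu> = distr \<mu> borel fst"

definition measure_support :: "'a::topological_space measure \<Rightarrow> 'a set" where
  "measure_support M = {x. \<forall>U. open U \<and> x \<in> U \<longrightarrow> emeasure M U > 0}"

text \<open>\<open>g\<close> is a version of the conditional expectation of \<open>r\<close> given \<open>l\<close>, as a function of \<open>l\<close>.\<close>

definition overlap_cond_exp :: "(real \<times> real) measure \<Rightarrow> (real \<Rightarrow> real) \<Rightarrow> bool" where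
  "overlap_cond_exp \<mu> g \<longleftrightarrow>
     g \<in> borel_measurable borel \<and>
     (AE p in \<mu>. real_cond_exp \<mu> (vimage_algebra (space \<mu>) fst borel) snd p = g (fst p))"

text \<open>Conditional expectations are determined only almost everywhere, so the ratio condition is
  asked of some pair of versions. The quotient is taken in \<open>ennreal\<close>: there a positive number
  divided by \<open>0\<close> is \<open>\<infinity>\<close>, whereas over the reals it would be \<open>0\<close> and an infinite ratio would
  count as a small one (\<open>0 / 0\<close> is \<open>0\<close>). Where the denominator is positive this is the
  ordinary quotient.\<close>

definition ljsd_le :: "(real \<times> real) measure \<Rightarrow> (real \<times> real) measure \<Rightarrow> bool" where
  "ljsd_le \<mu>1 \<mu>2 \<longleftrightarrow>
     train_marginal \<mu>1 = train_marginal \<mu>2 \<and>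
     (\<exists>g1 g2. overlap_cond_exp \<mu>1 g1 \<and> overlap_cond_exp \<mu>2 g2 \<and>
        mono_on (measure_support (train_marginal \<mu>1)) (\<lambda>l. ennreal (g1 l) / ennreal (g2 l))) \<and>
     (\<integral>p. snd p \<partial>\<mu>1) \<le> (\<integral>p. snd p \<partial>\<mu>2)"


section \<open>Activation constants\<close>

definition activation :: "(real \<Rightarrow> real) \<Rightarrow> bool" where
  "activation \<sigma> \<longleftrightarrow>
     (\<exists>c0 c1. (\<forall>u. \<bar>\<sigma> u\<bar> \<le> c0 * exp (c1 * \<bar>u\<bar>)) \<and>
        (AE u in lborel. \<sigma> differentiable (at u) \<and> \<bar>deriv \<sigma> u\<bar> \<le> c0 * exp (c1 * \<bar>u\<bar>)))"

text \<open>The law of \<open>z \<sim> N(0, t)\<close>. It lives on the Lebesgue sets because an almost everywhere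
  differentiable function is Lebesgue measurable but need not be Borel measurable.\<close>

definition gaussian :: "real \<Rightarrow> real measure" where
  "gaussian t = density lebesgue (\<lambda>z. ennreal (normal_density 0 (sqrt t) z))"

definition act_eta :: "(real \<Rightarrow> real) \<Rightarrow> real \<Rightarrow> real" where
  "act_eta \<sigma> t = (\<integral>z. (\<sigma> z - (\<integral>y. \<sigma> y \<partial>gaussian t))\<^sup>2 \<partial>gaussian t)"

definition act_rho :: "(real \<Rightarrow> real) \<Rightarrow> real \<Rightarrow> real" where
  "act_rho \<sigma> t = ((1 / t) * (\<integral>z. z * \<sigma> z \<partial>gaussian t))\<^sup>2"

definition act_zeta :: "(real \<Rightarrow> real) \<Rightarrow> real \<Rightarrow> real" where
  "act_zeta \<sigma> t = t * act_rho \<sigma> t"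

definition act_omega :: "(real \<Rightarrow> real) \<Rightarrow> real \<Rightarrow> real" where
  "act_omega \<sigma> t = t * (act_eta \<sigma> t / act_zeta \<sigma> t - 1)"

definition train_scale :: "(real \<times> real) measure \<Rightarrow> real" where
  "train_scale \<mu> = (\<integral>p. fst p \<partial>\<mu>)"

definition test_scale :: "(real \<times> real) measure \<Rightarrow> real" where
  "test_scale \<mu> = (\<integral>p. snd p \<partial>\<mu>)"

definition xi :: "(real \<Rightarrow> real) \<Rightarrow> (real \<times> real) measure \<Rightarrow> real" where
  "xi \<sigma> \<mu> = sqrt (act_rho \<sigma> (test_scale \<mu>) / act_rho \<sigma> (train_scale \<mu>))"


section \<open>Ridgeless limiting test error\<close>

definition I_fun :: "real \<Rightarrow> (real \<times> real) measure \<Rightarrow> nat \<Rightarrow> nat \<Rightarrow> real \<Rightarrow> real" where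
  "I_fun \<phi> \<mu> a b x = \<phi> * (\<integral>p. fst p ^ a / (\<phi> + x * fst p) ^ b \<partial>\<mu>)"

text \<open>The exponent \<open>a - 1\<close> is a truncated subtraction; only \<open>a \<ge> 1\<close> is meaningful.\<close>

definition I_star :: "real \<Rightarrow> (real \<times> real) measure \<Rightarrow> nat \<Rightarrow> nat \<Rightarrow> real \<Rightarrow> real" where
  "I_star \<phi> \<mu> a b x = \<phi> * (\<integral>p. snd p * fst p ^ (a - 1) / (\<phi> + x * fst p) ^ b \<partial>\<mu>)"

definition ridgeless_root ::
    "real \<Rightarrow> (real \<Rightarrow> real) \<Rightarrow> (real \<times> real) measure \<Rightarrow> real \<Rightarrow> bool" where
  "ridgeless_root \<phi> \<sigma> \<mu> x \<longleftrightarrow>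
     0 < x \<and> x = 1 / (act_omega \<sigma> (train_scale \<mu>) + I_fun \<phi> \<mu> 1 1 x)"

text \<open>There is at most one root. For an LJSD with \<open>\<phi> > 0\<close> and positive \<open>\<omega>\<close> it exists; if
  \<open>\<omega> = 0\<close> it exists precisely when \<open>\<phi>\<close> times the mass of \<open>l > 0\<close> exceeds \<open>1\<close>.\<close>

definition ridgeless_x :: "real \<Rightarrow> (real \<Rightarrow> real) \<Rightarrow> (real \<times> real) measure \<Rightarrow> real" where
  "ridgeless_x \<phi> \<sigma> \<mu> = (THE x. ridgeless_root \<phi> \<sigma> \<mu> x)"

definition bias :: "real \<Rightarrow> (real \<Rightarrow> real) \<Rightarrow> (real \<times> real) measure \<Rightarrow> real" where
  "bias \<phi> \<sigma> \<mu> =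
     (let x = ridgeless_x \<phi> \<sigma> \<mu>; \<xi> = xi \<sigma> \<mu> in
        (1 - \<xi>)\<^sup>2 * test_scale \<mu>
        + 2 * (1 - \<xi>) * \<xi> * I_star \<phi> \<mu> 1 1 x
        + \<xi>\<^sup>2 * \<phi> * I_star \<phi> \<mu> 1 2 x)"

text \<open>The argument \<open>v\<close> is the variance of the label noise.\<close>

definition variance_term ::
    "real \<Rightarrow> real \<Rightarrow> real \<Rightarrow> (real \<Rightarrow> real) \<Rightarrow> (real \<times> real) measure \<Rightarrow> real" where
  "variance_term \<phi> \<psi> v \<sigma> \<mu> =
     (let x = ridgeless_x \<phi> \<sigma> \<mu>; \<xi> = xi \<sigma> \<mu>;
          \<omega> = act_omega \<sigma> (train_scale \<mu>); \<omega>s = act_omega \<sigma> (test_scale \<mu>) in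
        \<xi>\<^sup>2 * (\<psi> / (\<phi> - \<psi>)) * x * (v + I_fun \<phi> \<mu> 1 1 x) * (\<omega>s + I_star \<phi> \<mu> 1 1 x)
        + \<xi>\<^sup>2 * x * (1 - x * (\<omega> - v) / (1 - x\<^sup>2 * I_fun \<phi> \<mu> 2 2 x)) * I_star \<phi> \<mu> 2 2 x)"

definition test_error ::
    "real \<Rightarrow> real \<Rightarrow> real \<Rightarrow> (real \<Rightarrow> real) \<Rightarrow> (real \<times> real) measure \<Rightarrow> real" where
  "test_error \<phi> \<psi> v \<sigma> \<mu> = bias \<phi> \<sigma> \<mu> + variance_term \<phi> \<psi> v \<sigma> \<mu>"

definition slope ::
    "real \<Rightarrow> (real \<Rightarrow> real) \<Rightarrow> (real \<times> real) measure \<Rightarrow> (real \<times> real) measure \<Rightarrow> real" where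
  "slope \<phi> \<sigma> \<mu>1 \<mu>2 =
     (xi \<sigma> \<mu>2)\<^sup>2 / (xi \<sigma> \<mu>1)\<^sup>2 *
     ((act_omega \<sigma> (test_scale \<mu>2) + I_star \<phi> \<mu>2 1 1 (ridgeless_x \<phi> \<sigma> \<mu>2)) /
      (act_omega \<sigma> (test_scale \<mu>1) + I_star \<phi> \<mu>1 1 1 (ridgeless_x \<phi> \<sigma> \<mu>1)))"

end

theory Submission imports Defs begin

text \<open>The root \<open>x\<close> and the unstarred functionals \<open>I\<close> depend on the LJSD only through the marginal of \<open>l\<close>, so
  \<open>\<psi>\<close> enters the error only through the factor \<open>\<psi> / (\<phi> - \<psi>) * x * (v + I\<^sub>1\<^sub>1)\<close>, common to both
  measures, multiplied by \<open>\<xi>\<^sup>2 * (\<omega>\<^sub>* + I\<^sup>*\<^sub>1\<^sub>1) > 0\<close>; the slope is the quotient of the latter factors.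
  Since \<open>\<rho> * \<omega> = \<eta> - \<zeta>\<close> and \<open>\<rho> = \<zeta> / s\<close>, it is also the quotient of the two values of
  \<open>(\<eta> - \<zeta>) + \<zeta> * (I\<^sup>*\<^sub>1\<^sub>1 / s)\<close>. The first summand grows by the hypothesis on the constants and
  \<open>\<zeta> \<le> \<eta>\<close> (Cauchy-Schwarz). The last factor is the mean of the decreasing function
  \<open>\<phi> / (\<phi> + x * l)\<close> under the law of \<open>l\<close> reweighted by \<open>E[r | l] / s\<close>, and it grows because the
  likelihood ratio of the two reweighted laws is monotone.\<close>

section \<open>The Gaussian constants\<close>

text \<open>The measure \<open>gaussian t\<close> lives on the completed sigma-algebra. A Borel
  integrand does not see the completion, so known facts about normal densities over
  \<open>lborel\<close> carry over.\<close>

lemma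
  fixes f :: "real \<Rightarrow> real"
  assumes f: "f \<in> borel_measurable borel"
  shows integrable_gaussian_borel:
      "integrable (gaussian t) f \<longleftrightarrow> integrable lborel (\<lambda>z. normal_density 0 (sqrt t) z * f z)"
    and integral_gaussian_borel:
      "(\<integral>z. f z \<partial>gaussian t) = (\<integral>z. normal_density 0 (sqrt t) z * f z \<partial>lborel)"
proof -
  have [measurable]: "f \<in> borel_measurable borel" by (rule f)
  have m: "normal_density 0 (sqrt t) \<in> borel_measurable lebesgue" "f \<in> borel_measurable lebesgue"
    by (auto intro!: measurable_completion)
  have p: "(\<lambda>z. normal_density 0 (sqrt t) z * f z) \<in> borel_measurable lborel"
    by simp
  show "integrable (gaussian t) f \<longleftrightarrow> integrable lborel (\<lambda>z. normal_density 0 (sqrt t) z * f z)"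
    unfolding gaussian_def using m p
    by (simp add: integrable_density integrable_completion)
  show "(\<integral>z. f z \<partial>gaussian t) = (\<integral>z. normal_density 0 (sqrt t) z * f z \<partial>lborel)"
    unfolding gaussian_def using m p
    by (simp add: integral_density integral_completion)
qed

text \<open>Completing the square turns \<open>exp (d * z)\<close> times the density of N(0, t) into
  a constant multiple of the density of N(d t, t). These exponentials dominate all integrands
  involving the activation.\<close>

lemma integrable_gaussian_exp_abs:
  assumes t: "0 < t"
  shows "integrable (gaussian t) (\<lambda>z. exp (c * \<bar>z\<bar>))"
proof -
  have exp_linear: "integrable (gaussian t) (\<lambda>z. exp (d * z))" for d
  proof -
    have "normal_density 0 (sqrt t) z * exp (d * z)
        = exp (d\<^sup>2 * t / 2) * normal_density (d * t) (sqrt t) z" for z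
    proof -
      have "- (z\<^sup>2 / (2 * t)) + d * z = d\<^sup>2 * t / 2 - (z - d * t)\<^sup>2 / (2 * t)"
        using t by (simp add: field_simps power2_eq_square)
      then have "exp (- (z\<^sup>2 / (2 * t))) * exp (d * z)
          = exp (d\<^sup>2 * t / 2) * exp (- ((z - d * t)\<^sup>2 / (2 * t)))"
        by (simp flip: exp_add)
      then show ?thesis
        using t by (simp add: normal_density_def)
    qed
    then show ?thesis
      using t by (simp add: integrable_gaussian_borel integrable_normal_density)
  qed
  show ?thesis
  proof (rule Bochner_Integration.integrable_bound)
    show "integrable (gaussian t) (\<lambda>z. exp (c * z) + exp (- c * z))"
      by (intro Bochner_Integration.integrable_add exp_linear)
    show "(\<lambda>z. exp (c * \<bar>z\<bar>)) \<in> borel_measurable (gaussian t)"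
      unfolding gaussian_def by (simp add: measurable_completion)
    show "AE z in gaussian t. norm (exp (c * \<bar>z\<bar>)) \<le> norm (exp (c * z) + exp (- c * z))"
      by (simp add: abs_of_pos[OF add_pos_pos]) (simp add: abs_if)
  qed
qed

text \<open>The set \<open>D\<close> of points of differentiability has null complement, so
  completeness makes it Lebesgue measurable. The activation is continuous on \<open>D\<close>, and
  its values off \<open>D\<close> do not affect measurability.\<close>

lemma borel_measurable_activation:
  assumes "activation \<sigma>"
  shows "\<sigma> \<in> borel_measurable lebesgue"
proof -
  define D where "D = {u. \<sigma> differentiable (at u)}"
  have "AE u in lborel. u \<in> D"
    using assms unfolding activation_def D_def by auto
  then have D: "AE u in lebesgue. u \<in> D"
    by (rule AE_completion)
  then have "- D \<in> null_sets lebesgue"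
    by (simp add: completion.AE_iff_null_sets Compl_eq)
  then have "D \<in> sets lebesgue"
    using Compl_in_sets_lebesgue by blast
  moreover have "continuous_on D \<sigma>"
    unfolding D_def
    by (intro continuous_at_imp_continuous_on) (auto intro: differentiable_imp_continuous_within)
  ultimately have "(\<lambda>u. if u \<in> D then \<sigma> u else 0) \<in> borel_measurable lebesgue"
    by (intro borel_measurable_if_I continuous_imp_measurable_on_sets_lebesgue)
  then show ?thesis
    by (rule borel_measurable_AE) (use D in auto)
qed

text \<open>All three follow from the exponential growth bound: squaring doubles the rate, and
  multiplying by \<open>z\<close> raises it by one because
  \<open>\<bar>z\<bar> \<le> exp \<bar>z\<bar>\<close>.\<close>

lemma
  assumes t: "0 < t" and act: "activation \<sigma>"
  shows integrable_gaussian_activation_sq: "integrable (gaussian t) (\<lambda>z. (\<sigma> z)\<^sup>2)"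
    and integrable_gaussian_activation_mult: "integrable (gaussian t) (\<lambda>z. z * \<sigma> z)"
    and integrable_gaussian_activation: "integrable (gaussian t) \<sigma>"
proof -
  obtain c0 c1 where c: "\<And>u. \<bar>\<sigma> u\<bar> \<le> c0 * exp (c1 * \<bar>u\<bar>)"
    using act unfolding activation_def by blast
  have \<sigma> [measurable]: "\<sigma> \<in> borel_measurable (gaussian t)"
    using borel_measurable_activation[OF act] by (simp add: gaussian_def)
  have id [measurable]: "(\<lambda>z. z) \<in> borel_measurable (gaussian t)"
    by (simp add: gaussian_def measurable_completion)
  have bound: "integrable (gaussian t) f"
    if "f \<in> borel_measurable (gaussian t)" "\<And>z. \<bar>f z\<bar> \<le> k * exp (d * \<bar>z\<bar>)"
    for f :: "real \<Rightarrow> real" and k d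
    by (rule Bochner_Integration.integrable_bound[where f = "\<lambda>z. k * exp (d * \<bar>z\<bar>)"])
      (use that integrable_gaussian_exp_abs[OF t] in \<open>auto intro: order_trans[OF _ abs_ge_self]\<close>)
  show "integrable (gaussian t) \<sigma>"
    by (rule bound[OF \<sigma> c])
  show "integrable (gaussian t) (\<lambda>z. (\<sigma> z)\<^sup>2)"
  proof (rule bound)
    fix z
    have "\<bar>\<sigma> z\<bar>\<^sup>2 \<le> (c0 * exp (c1 * \<bar>z\<bar>))\<^sup>2"
      using c by (intro power_mono) auto
    then show "\<bar>(\<sigma> z)\<^sup>2\<bar> \<le> c0\<^sup>2 * exp ((2 * c1) * \<bar>z\<bar>)"
      by (simp add: power_mult_distrib mult.assoc flip: exp_double)
  qed simp
  show "integrable (gaussian t) (\<lambda>z. z * \<sigma> z)"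
  proof (rule bound)
    fix z :: real
    have "\<bar>z\<bar> \<le> exp \<bar>z\<bar>"
      using exp_ge_add_one_self[of "\<bar>z\<bar>"] by linarith
    then have "\<bar>z\<bar> * \<bar>\<sigma> z\<bar> \<le> exp \<bar>z\<bar> * (c0 * exp (c1 * \<bar>z\<bar>))"
      using c by (intro mult_mono) auto
    then show "\<bar>z * \<sigma> z\<bar> \<le> c0 * exp ((c1 + 1) * \<bar>z\<bar>)"
      by (simp add: abs_mult distrib_right mult.left_commute exp_add mult.commute[of "exp \<bar>z\<bar>"])
  qed simp
qed

text \<open>Cauchy-Schwarz for \<open>z\<close> and \<open>\<sigma> z - E[\<sigma> z]\<close>, in the form that the residual of the linear
  regression of the latter on the former has a nonnegative second moment.\<close>

lemma act_zeta_le_act_eta: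
  assumes t: "0 < t" and act: "activation \<sigma>"
  shows "act_zeta \<sigma> t \<le> act_eta \<sigma> t"
proof -
  define m where "m = (\<integral>z. \<sigma> z \<partial>gaussian t)"
  \<comment> \<open>This is the regression coefficient E[z \<sigma>(z)] / E[z^2], whose square is
    \<open>act_rho \<sigma> t\<close>.\<close>
  define a where "a = (1 / t) * (\<integral>z. z * \<sigma> z \<partial>gaussian t)"
  have s: "0 < sqrt t" using t by simp
  have one: "integrable (gaussian t) (\<lambda>z. 1 :: real)"
    using integrable_gaussian_exp_abs[OF t, of 0] by simp
  have z1: "integrable (gaussian t) (\<lambda>z. z)" "(\<integral>z. z \<partial>gaussian t) = 0"
    using integrable_normal_moment_nz_1[OF s, of 0] integral_normal_moment_nz_1[OF s, of 0]
    by (simp_all add: integrable_gaussian_borel integral_gaussian_borel)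
  have z2: "integrable (gaussian t) (\<lambda>z. z\<^sup>2)" "(\<integral>z. z\<^sup>2 \<partial>gaussian t) = t"
    using integrable_normal_moment[OF s, of 0 2] integral_normal_moment_even[OF s, of 0 1] t
    by (simp_all add: integrable_gaussian_borel integral_gaussian_borel)
  note int = one z1(1) z2(1) integrable_gaussian_activation_sq[OF t act]
    integrable_gaussian_activation_mult[OF t act] integrable_gaussian_activation[OF t act]
  have sq: "integrable (gaussian t) (\<lambda>z. (\<sigma> z - m)\<^sup>2)"
  proof -
    have "integrable (gaussian t) (\<lambda>z. (\<sigma> z)\<^sup>2 - 2 * m * \<sigma> z + m\<^sup>2 * 1)"
      by (intro Bochner_Integration.integrable_add Bochner_Integration.integrable_diff
          Bochner_Integration.integrable_mult_right int)
    then show ?thesis by (simp add: power2_diff algebra_simps)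
  qed
  have "0 \<le> (\<integral>z. (\<sigma> z - m - a * z)\<^sup>2 \<partial>gaussian t)"
    by simp
  also have "\<dots> = (\<integral>z. (\<sigma> z - m)\<^sup>2 - 2 * a * (z * \<sigma> z) + 2 * a * m * z + a\<^sup>2 * z\<^sup>2 \<partial>gaussian t)"
    by (intro Bochner_Integration.integral_cong refl) (simp add: power2_eq_square algebra_simps)
  also have "\<dots> = act_eta \<sigma> t - 2 * a * (t * a) + a\<^sup>2 * t"
    using sq int z1(2) z2(2) t
    by (simp add: act_eta_def flip: m_def) (simp add: a_def)
  also have "\<dots> = act_eta \<sigma> t - act_zeta \<sigma> t"
    by (simp add: act_zeta_def act_rho_def a_def power2_eq_square)
  finally show ?thesis by simp
qed

lemma act_rho_nonneg: "0 \<le> act_rho \<sigma> t"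
  by (simp add: act_rho_def)

lemma act_rho_pos:
  assumes "act_zeta \<sigma> t \<noteq> 0"
  shows "0 < act_rho \<sigma> t"
  using assms act_rho_nonneg[of \<sigma> t] by (auto simp: act_zeta_def less_le)

lemma act_zeta_pos:
  assumes "0 < t" and "act_zeta \<sigma> t \<noteq> 0"
  shows "0 < act_zeta \<sigma> t"
  using assms act_rho_pos[OF assms(2)] by (simp add: act_zeta_def)

text \<open>Since \<zeta> = t \<rho>, the quotient t / \<zeta> inside \<omega> is 1 / \<rho>. This
  removes \<omega> from the slope in favour of \<eta> and \<zeta>.\<close>

lemma act_rho_mult_act_omega:
  assumes "act_zeta \<sigma> t \<noteq> 0"
  shows "act_rho \<sigma> t * act_omega \<sigma> t = act_eta \<sigma> t - act_zeta \<sigma> t"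
  using assms by (simp add: act_omega_def act_zeta_def field_simps)

lemma act_omega_nonneg:
  assumes "0 < t" and "activation \<sigma>" and "act_zeta \<sigma> t \<noteq> 0"
  shows "0 \<le> act_omega \<sigma> t"
  using assms act_zeta_le_act_eta[of t \<sigma>] act_zeta_pos[of t \<sigma>] by (simp add: act_omega_def)

lemma xi_squared:
  "(xi \<sigma> \<mu>)\<^sup>2 = act_rho \<sigma> (test_scale \<mu>) / act_rho \<sigma> (train_scale \<mu>)"
  by (simp add: xi_def act_rho_nonneg)

section \<open>The ridgeless root\<close>

lemma ljsdD:
  assumes "ljsd \<mu>"
  shows "prob_space \<mu>"
    and "AE p in \<mu>. 0 \<le> fst p" and "AE p in \<mu>. 0 \<le> snd p"
    and "integrable \<mu> fst" and "integrable \<mu> snd"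
    and "0 < train_scale \<mu>" and "0 < test_scale \<mu>"
proof -
  obtain C where "AE p in \<mu>. p \<in> {0..C} \<times> {0..C}"
    using assms unfolding ljsd_def by blast
  then show "AE p in \<mu>. 0 \<le> fst p" "AE p in \<mu>. 0 \<le> snd p"
    by (eventually_elim, auto)+
qed (use assms in \<open>auto simp: ljsd_def train_scale_def test_scale_def\<close>)

lemma
  assumes "ljsd \<mu>"
  shows measurable_ljsd_fst: "fst \<in> borel_measurable \<mu>"
    and measurable_ljsd_snd: "snd \<in> borel_measurable \<mu>"
  using ljsdD(4,5)[OF assms] by auto

text \<open>If the integral vanished, the nonnegative integrand would be zero almost everywhere;
  dividing by the positive weight, so would \<open>f\<close>, against its positive integral.\<close>

lemma integral_mult_pos:
  fixes f w :: "'a \<Rightarrow> real"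
  assumes f: "0 < (\<integral>x. f x \<partial>M)" and nonneg: "AE x in M. 0 \<le> f x" and pos: "AE x in M. 0 < w x"
    and int: "integrable M (\<lambda>x. f x * w x)"
  shows "0 < (\<integral>x. f x * w x \<partial>M)"
proof -
  have fw: "AE x in M. 0 \<le> f x * w x"
    using nonneg pos by eventually_elim simp
  have "(\<integral>x. f x * w x \<partial>M) \<noteq> 0"
  proof
    assume "(\<integral>x. f x * w x \<partial>M) = 0"
    then have "AE x in M. f x * w x = 0"
      using integral_nonneg_eq_0_iff_AE[OF int fw] by simp
    with pos have "AE x in M. f x = 0"
      by eventually_elim auto
    then have "(\<integral>x. f x \<partial>M) = 0"
      by (rule integral_eq_zero_AE)
    with f show False by simp
  qed
  moreover have "0 \<le> (\<integral>x. f x * w x \<partial>M)"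
    using fw by (rule integral_nonneg_AE)
  ultimately show ?thesis by simp
qed

text \<open>The weight is at most 1 / \<phi> because the eigenvalue is nonnegative almost
  everywhere. The product form allows two weights to be attached in succession.\<close>

lemma integrable_mult_inverse_affine:
  fixes f :: "real \<times> real \<Rightarrow> real"
  assumes \<mu>: "ljsd \<mu>" and \<phi>: "0 < \<phi>" and x: "0 \<le> x" and f: "integrable \<mu> f"
  shows "integrable \<mu> (\<lambda>p. f p * (1 / (\<phi> + x * fst p)))"
proof (rule Bochner_Integration.integrable_bound[where f = "\<lambda>p. f p * (1 / \<phi>)"])
  have [measurable]: "fst \<in> borel_measurable \<mu>" "f \<in> borel_measurable \<mu>"
    using measurable_ljsd_fst[OF \<mu>] f by auto
  show "(\<lambda>p. f p * (1 / (\<phi> + x * fst p))) \<in> borel_measurable \<mu>"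
    by simp
  show "AE p in \<mu>. norm (f p * (1 / (\<phi> + x * fst p))) \<le> norm (f p * (1 / \<phi>))"
    using ljsdD(2)[OF \<mu>]
  proof eventually_elim
    case (elim p)
    then have "\<phi> \<le> \<phi> + x * fst p" using x by simp
    then have "1 / (\<phi> + x * fst p) \<le> 1 / \<phi>" "0 < \<phi> + x * fst p"
      using \<phi> by (auto intro!: divide_left_mono)
    then show ?case
      using \<phi> by (simp only: norm_mult) (intro mult_left_mono, auto)
  qed
qed (use f in simp)

text \<open>This keeps the denominator of the slope positive even when \<omega> vanishes, as it does
  for a linear activation.\<close>

lemma I_star_1_1_pos:
  assumes \<mu>: "ljsd \<mu>" and \<phi>: "0 < \<phi>" and x: "0 \<le> x"
  shows "0 < I_star \<phi> \<mu> 1 1 x"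
proof -
  have "AE p in \<mu>. 0 < 1 / (\<phi> + x * fst p)"
    using ljsdD(2)[OF \<mu>] by eventually_elim (use \<phi> x in \<open>simp add: add_pos_nonneg\<close>)
  with ljsdD(3,5,7)[OF \<mu>] have "0 < (\<integral>p. snd p * (1 / (\<phi> + x * fst p)) \<partial>\<mu>)"
    by (intro integral_mult_pos integrable_mult_inverse_affine[OF \<mu> \<phi> x])
      (auto simp: test_scale_def)
  with \<phi> show ?thesis
    by (simp add: I_star_def)
qed

text \<open>Subtracting the fractions leaves \<phi> (y - x) l / ((\<phi> + x l) (\<phi> + y l)),
  whose mean is positive because l has positive mean.\<close>

lemma mult_I_fun_1_1_strict_mono:
  assumes \<mu>: "ljsd \<mu>" and \<phi>: "0 < \<phi>" and x: "0 < x" and "x < y"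
  shows "x * I_fun \<phi> \<mu> 1 1 x < y * I_fun \<phi> \<mu> 1 1 y"
proof -
  have y: "0 < y" using assms by simp
  define w where "w p = (1 / (\<phi> + x * fst p)) * (1 / (\<phi> + y * fst p))" for p :: "real \<times> real"
  note int1 = integrable_mult_inverse_affine[OF \<mu> \<phi> less_imp_le]
  have int: "integrable \<mu> (\<lambda>p. fst p * w p)"
    using int1[OF y int1[OF x ljsdD(4)[OF \<mu>]]] by (simp add: w_def mult.assoc)
  have "AE p in \<mu>. 0 < w p"
    using ljsdD(2)[OF \<mu>] by eventually_elim (use \<phi> x y in \<open>simp add: w_def add_pos_nonneg\<close>)
  then have pos: "0 < (\<integral>p. fst p * w p \<partial>\<mu>)"
    using ljsdD(2,6)[OF \<mu>] int by (intro integral_mult_pos) (auto simp: train_scale_def)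
  have "y * (\<integral>p. fst p * (1 / (\<phi> + y * fst p)) \<partial>\<mu>) - x * (\<integral>p. fst p * (1 / (\<phi> + x * fst p)) \<partial>\<mu>)
      = (\<integral>p. y * (fst p * (1 / (\<phi> + y * fst p))) - x * (fst p * (1 / (\<phi> + x * fst p))) \<partial>\<mu>)"
    using int1[OF y ljsdD(4)[OF \<mu>]] int1[OF x ljsdD(4)[OF \<mu>]]
    by (subst Bochner_Integration.integral_diff) (simp_all only: integrable_mult_right integral_mult_right_zero)
  also have "\<dots> = (\<integral>p. \<phi> * (y - x) * (fst p * w p) \<partial>\<mu>)"
  proof (rule integral_cong_AE)
    show "AE p in \<mu>. y * (fst p * (1 / (\<phi> + y * fst p))) - x * (fst p * (1 / (\<phi> + x * fst p)))
        = \<phi> * (y - x) * (fst p * w p)"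
      using ljsdD(2)[OF \<mu>]
    proof eventually_elim
      case (elim p)
      then have "\<phi> + y * fst p \<noteq> 0" "\<phi> + x * fst p \<noteq> 0"
        using \<phi> x y by (metis add_pos_nonneg less_imp_le mult_nonneg_nonneg less_irrefl)+
      then show ?case by (simp add: w_def field_simps)
    qed
  qed (use measurable_ljsd_fst[OF \<mu>] in \<open>simp_all add: w_def\<close>)
  also have "\<dots> = \<phi> * (y - x) * (\<integral>p. fst p * w p \<partial>\<mu>)"
    by simp
  also have "\<dots> > 0"
    using pos \<phi> \<open>x < y\<close> by simp
  finally have "x * (\<integral>p. fst p / (\<phi> + x * fst p) \<partial>\<mu>) < y * (\<integral>p. fst p / (\<phi> + y * fst p) \<partial>\<mu>)"
    by simp
  with \<phi> show ?thesis
    by (simp add: I_fun_def mult.left_commute)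
qed

text \<open>Clearing the denominator gives u \<omega> + u I(u) = 1 with I =
  \<open>I_fun \<phi> \<mu> 1 1\<close>. For \<omega> \<ge> 0 the left side is strictly increasing
  in u > 0.\<close>

lemma ridgeless_root_unique:
  assumes \<mu>: "ljsd \<mu>" and \<phi>: "0 < \<phi>" and \<omega>: "0 \<le> act_omega \<sigma> (train_scale \<mu>)"
    and x: "ridgeless_root \<phi> \<sigma> \<mu> x" and y: "ridgeless_root \<phi> \<sigma> \<mu> y"
  shows "x = y"
proof -
  let ?\<omega> = "act_omega \<sigma> (train_scale \<mu>)"
  have root: "u * ?\<omega> + u * I_fun \<phi> \<mu> 1 1 u = 1" if "ridgeless_root \<phi> \<sigma> \<mu> u" for u
  proof -
    let ?d = "?\<omega> + I_fun \<phi> \<mu> 1 1 u"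
    have "0 < u" "u = 1 / ?d"
      using that by (auto simp: ridgeless_root_def)
    \<comment> \<open>Division by zero yields zero, which would contradict
      \<open>0 < u\<close>.\<close>
    then have "?d \<noteq> 0" by (metis div_by_0 less_irrefl)
    then have "u * ?d = 1"
      using \<open>u = 1 / ?d\<close> by (metis nonzero_divide_eq_eq)
    then show ?thesis by (simp add: distrib_left)
  qed
  have "\<not> u < v" if "ridgeless_root \<phi> \<sigma> \<mu> u" "ridgeless_root \<phi> \<sigma> \<mu> v" for u v
  proof
    assume "u < v"
    moreover have "0 < u" using that by (simp add: ridgeless_root_def)
    ultimately have "u * ?\<omega> \<le> v * ?\<omega>" "u * I_fun \<phi> \<mu> 1 1 u < v * I_fun \<phi> \<mu> 1 1 v"
      using \<omega> mult_I_fun_1_1_strict_mono[OF \<mu> \<phi>] by (auto intro: mult_right_mono)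
    with root[OF that(1)] root[OF that(2)] show False by simp
  qed
  with x y show ?thesis by (meson linorder_neqE)
qed

lemma ridgeless_x_pos:
  assumes "ljsd \<mu>" and "0 < \<phi>" and "0 \<le> act_omega \<sigma> (train_scale \<mu>)"
    and "\<exists>x. ridgeless_root \<phi> \<sigma> \<mu> x"
  shows "0 < ridgeless_x \<phi> \<sigma> \<mu>"
proof -
  have "\<exists>!x. ridgeless_root \<phi> \<sigma> \<mu> x"
    using assms ridgeless_root_unique by blast
  then have "ridgeless_root \<phi> \<sigma> \<mu> (ridgeless_x \<phi> \<sigma> \<mu>)"
    unfolding ridgeless_x_def by (rule theI')
  then show ?thesis by (simp add: ridgeless_root_def)
qed

section \<open>Dependence on the training marginal\<close>

lemma integral_fst_train_marginal:
  fixes f :: "real \<Rightarrow> real"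
  assumes "ljsd \<mu>" and "f \<in> borel_measurable borel"
  shows "(\<integral>p. f (fst p) \<partial>\<mu>) = (\<integral>l. f l \<partial>train_marginal \<mu>)"
  unfolding train_marginal_def
  using assms by (simp add: integral_distr[OF measurable_ljsd_fst])

text \<open>The root condition becomes the same predicate for both measures, so the two
  \<open>THE\<close> terms agree whether or not a root exists.\<close>

lemma
  assumes "ljsd \<mu>1" "ljsd \<mu>2" and eq: "train_marginal \<mu>1 = train_marginal \<mu>2"
  shows train_scale_cong: "train_scale \<mu>1 = train_scale \<mu>2"
    and I_fun_cong: "I_fun \<phi> \<mu>1 a b x = I_fun \<phi> \<mu>2 a b x"
    and ridgeless_x_cong: "ridgeless_x \<phi> \<sigma> \<mu>1 = ridgeless_x \<phi> \<sigma> \<mu>2"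
proof -
  have cong: "(\<integral>p. f (fst p) \<partial>\<mu>1) = (\<integral>p. f (fst p) \<partial>\<mu>2)"
    if "f \<in> borel_measurable borel" for f :: "real \<Rightarrow> real"
    using integral_fst_train_marginal[OF assms(1) that]
      integral_fst_train_marginal[OF assms(2) that] eq by simp
  show scale: "train_scale \<mu>1 = train_scale \<mu>2"
    using cong[of "\<lambda>l. l"] by (simp add: train_scale_def)
  have I: "I_fun \<phi> \<mu>1 a b x = I_fun \<phi> \<mu>2 a b x" for a b x
    using cong[of "\<lambda>l. l ^ a / (\<phi> + x * l) ^ b"] by (simp add: I_fun_def)
  then show "I_fun \<phi> \<mu>1 a b x = I_fun \<phi> \<mu>2 a b x" .
  show "ridgeless_x \<phi> \<sigma> \<mu>1 = ridgeless_x \<phi> \<sigma> \<mu>2"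
    by (simp add: ridgeless_x_def ridgeless_root_def scale I)
qed

section \<open>Monotone likelihood ratios\<close>

text \<open>Each point outside the support has a null basic neighbourhood. The basis is countable,
  so the union of its null members is null.\<close>

lemma AE_in_measure_support:
  fixes M :: "'a::second_countable_topology measure"
  assumes "sets M = sets borel"
  shows "AE x in M. x \<in> measure_support M"
proof -
  obtain B :: "'a set set" where B: "countable B" "topological_basis B"
    using ex_countable_basis by blast
  let ?N = "\<Union>U\<in>{U\<in>B. emeasure M U = 0}. U"
  have "?N \<in> null_sets M"
  proof (rule null_sets_UN')
    show "countable {U \<in> B. emeasure M U = 0}"
      by (rule countable_subset[OF _ B(1)]) blast
    show "U \<in> null_sets M" if "U \<in> {U \<in> B. emeasure M U = 0}" for U
      using that assms topological_basis_open[OF B(2)] by (intro null_setsI) simp_all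
  qed
  moreover have "x \<in> ?N" if x: "x \<notin> measure_support M" for x
  proof -
    obtain U where U: "open U" "x \<in> U" "emeasure M U = 0"
      using x unfolding measure_support_def by (auto simp: zero_less_iff_neq_zero)
    obtain V where V: "V \<in> B" "x \<in> V" "V \<subseteq> U"
      using topological_basisE[OF B(2) U(1,2)] .
    have "emeasure M V \<le> emeasure M U"
      using U(1) V(3) assms by (intro emeasure_mono) simp_all
    then have "emeasure M V = 0"
      using U(3) by simp
    with V(1,2) show ?thesis by blast
  qed
  then have "{x \<in> space M. x \<notin> measure_support M} \<subseteq> ?N"
    by blast
  ultimately show ?thesis
    by (rule AE_I')
qed

text \<open>The conventions \<open>a / 0 = \<infinity>\<close> for \<open>a > 0\<close> and \<open>0 / 0 = 0\<close> of \<open>ennreal\<close> are harmless here.\<close>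

lemma ennreal_ratio_le_imp_cross_mult_le:
  assumes nonneg: "0 \<le> a" "0 \<le> b" "0 \<le> c" "0 \<le> d"
    and le: "ennreal a / ennreal b \<le> ennreal c / ennreal d"
  shows "a * d \<le> c * b"
proof (cases "a = 0 \<or> d = 0")
  case True
  then show ?thesis using nonneg by auto
next
  case False
  then have pos: "0 < a" "0 < d" using nonneg by auto
  show ?thesis
  \<comment> \<open>If \<open>b = 0\<close>, the left ratio is infinite while the right one is
    finite, so the assumed inequality fails.\<close>
  proof (cases "b = 0")
    case True
    then have "ennreal a / ennreal b = top"
      using pos by (simp add: ennreal_divide_zero)
    moreover have "ennreal c / ennreal d \<noteq> top"
      using pos nonneg by (simp add: divide_ennreal)
    ultimately show ?thesis using le by (simp add: top_unique)
  next
    case False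
    then have "a / b \<le> c / d"
      using le pos nonneg by (simp add: divide_ennreal)
    then show ?thesis
      using False pos nonneg by (simp add: field_simps)
  qed
qed

lemma integral_nonpos_AE:
  fixes f :: "'a \<Rightarrow> real"
  assumes "AE x in M. f x \<le> 0"
  shows "(\<integral>x. f x \<partial>M) \<le> 0"
  using integral_nonneg_AE[where M = M and f = "\<lambda>x. - f x"] assms by simp

text \<open>Chebyshev's argument: \<open>(g1 l * g2 m - g1 m * g2 l) * (h l - h m) \<le> 0\<close> is integrated over
  \<open>m\<close> and then over \<open>l\<close>.\<close>

lemma integral_mult_le_of_monotone_ratio:
  fixes g1 g2 h :: "'a::linorder \<Rightarrow> real"
  assumes int: "integrable M g1" "integrable M g2"
      "integrable M (\<lambda>l. g1 l * h l)" "integrable M (\<lambda>l. g2 l * h l)"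
    and S: "AE l in M. l \<in> S"
    and h: "\<And>l m. l \<in> S \<Longrightarrow> m \<in> S \<Longrightarrow> l \<le> m \<Longrightarrow> h m \<le> h l"
    and ratio: "\<And>l m. l \<in> S \<Longrightarrow> m \<in> S \<Longrightarrow> l \<le> m \<Longrightarrow> g1 l * g2 m \<le> g1 m * g2 l"
  shows "(\<integral>l. g1 l * h l \<partial>M) * (\<integral>l. g2 l \<partial>M) \<le> (\<integral>l. g1 l \<partial>M) * (\<integral>l. g2 l * h l \<partial>M)"
proof -
  define A1 A2 B1 B2 where AB: "A1 = (\<integral>l. g1 l \<partial>M)" "A2 = (\<integral>l. g2 l \<partial>M)"
    "B1 = (\<integral>l. g1 l * h l \<partial>M)" "B2 = (\<integral>l. g2 l * h l \<partial>M)"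
  \<comment> \<open>Expanded, each term is a function of l times a function of m. The iterated
    integration then needs only linearity, not a product measure.\<close>
  have F: "(g1 l * h l) * g2 m - g1 l * (g2 m * h m) - (g2 l * h l) * g1 m + g2 l * (g1 m * h m) \<le> 0"
    if "l \<in> S" "m \<in> S" for l m
  proof -
    have "(g1 l * g2 m - g1 m * g2 l) * (h l - h m) \<le> 0"
    proof (cases "l \<le> m")
      case True
      then show ?thesis
        using h[OF that] ratio[OF that] by (intro mult_nonpos_nonneg) simp_all
    next
      case False
      then show ?thesis
        using h[OF that(2,1)] ratio[OF that(2,1)]
        by (intro mult_nonneg_nonpos) (simp_all add: mult.commute[of "g1 l"] mult.commute[of "g1 m"])
    qed
    then show ?thesis by (simp add: algebra_simps)
  qed
  have inner: "(g1 l * h l) * A2 - g1 l * B2 - (g2 l * h l) * A1 + g2 l * B1 \<le> 0" if "l \<in> S" for l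
  proof -
    have "(\<integral>m. (g1 l * h l) * g2 m - g1 l * (g2 m * h m) - (g2 l * h l) * g1 m + g2 l * (g1 m * h m) \<partial>M) \<le> 0"
      using S by (intro integral_nonpos_AE, eventually_elim) (rule F[OF that])
    then show ?thesis
      using int by (simp add: AB)
  qed
  have "(\<integral>l. (g1 l * h l) * A2 - g1 l * B2 - (g2 l * h l) * A1 + g2 l * B1 \<partial>M) \<le> 0"
    using S by (intro integral_nonpos_AE, eventually_elim) (rule inner)
  \<comment> \<open>The four terms pair up to twice \<open>B1 * A2 - A1 * B2\<close>.\<close>
  then have "B1 * A2 - A1 * B2 - B2 * A1 + A2 * B1 \<le> 0"
    using int by (simp add: AB)
  then have "B1 * A2 \<le> A1 * B2"
    by (simp only: mult.commute[of B2 A1] mult.commute[of A2 B1])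
  then show ?thesis
    by (simp only: AB)
qed

section \<open>Conditional expectation of the overlap\<close>

text \<open>A function of the eigenvalue can be moved out of the conditional expectation given that
  eigenvalue; pushing forward to the marginal then replaces the overlap by \<open>g\<close>.\<close>

lemma
  assumes \<mu>: "ljsd \<mu>" and g: "overlap_cond_exp \<mu> g"
    and h: "h \<in> borel_measurable borel" and int: "integrable \<mu> (\<lambda>p. snd p * h (fst p))"
  shows integrable_overlap_cond_exp: "integrable (train_marginal \<mu>) (\<lambda>l. g l * h l)"
    and integral_overlap_cond_exp:
      "(\<integral>l. g l * h l \<partial>train_marginal \<mu>) = (\<integral>p. snd p * h (fst p) \<partial>\<mu>)"
    and overlap_cond_exp_nonneg: "AE l in train_marginal \<mu>. 0 \<le> g l"
proof -
  let ?F = "vimage_algebra (space \<mu>) fst (borel :: real measure)"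
  note [measurable] = measurable_ljsd_fst[OF \<mu>] measurable_ljsd_snd[OF \<mu>] h
  interpret prob_space \<mu> by (rule ljsdD(1)[OF \<mu>])
  have "subalgebra \<mu> ?F"
    using measurable_ljsd_fst[OF \<mu>] unfolding subalgebra_def measurable_iff_sets by simp
  then interpret sub: finite_measure_subalgebra \<mu> ?F
    by unfold_locales
  have gm [measurable]: "g \<in> borel_measurable borel"
    and ge: "AE p in \<mu>. real_cond_exp \<mu> ?F snd p = g (fst p)"
    using g by (auto simp: overlap_cond_exp_def)
  have fF: "fst \<in> borel_measurable ?F"
    by (rule measurable_vimage_algebra1) simp
  have hF: "(\<lambda>p. h (fst p)) \<in> borel_measurable ?F"
    by (rule measurable_compose[OF fF h])
  have int': "integrable \<mu> (\<lambda>p. h (fst p) * snd p)"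
    using int by (simp add: mult.commute)
  note ce = sub.real_cond_exp_intg[OF int' hF measurable_ljsd_snd[OF \<mu>]]
  have ae: "AE p in \<mu>. h (fst p) * real_cond_exp \<mu> ?F snd p = g (fst p) * h (fst p)"
    using ge by eventually_elim simp
  have [measurable]: "real_cond_exp \<mu> ?F snd \<in> borel_measurable \<mu>"
    by simp
  have meas: "(\<lambda>p. h (fst p) * real_cond_exp \<mu> ?F snd p) \<in> borel_measurable \<mu>"
    "(\<lambda>p. g (fst p) * h (fst p)) \<in> borel_measurable \<mu>"
    by measurable
  have "integrable \<mu> (\<lambda>p. g (fst p) * h (fst p))"
    using ce(1) integrable_cong_AE[OF meas ae] by simp
  then show "integrable (train_marginal \<mu>) (\<lambda>l. g l * h l)"
    unfolding train_marginal_def by (simp add: integrable_distr_eq)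
  have "(\<integral>l. g l * h l \<partial>train_marginal \<mu>) = (\<integral>p. g (fst p) * h (fst p) \<partial>\<mu>)"
    using integral_fst_train_marginal[OF \<mu>, of "\<lambda>l. g l * h l"] by simp
  also have "\<dots> = (\<integral>p. snd p * h (fst p) \<partial>\<mu>)"
    using ce(2) integral_cong_AE[OF meas ae] by (simp add: mult.commute)
  finally show "(\<integral>l. g l * h l \<partial>train_marginal \<mu>) = (\<integral>p. snd p * h (fst p) \<partial>\<mu>)" .
  have "AE p in \<mu>. 0 \<le> real_cond_exp \<mu> ?F snd p"
    by (rule sub.real_cond_exp_pos[OF ljsdD(3)[OF \<mu>]]) simp
  with ge have "AE p in \<mu>. 0 \<le> g (fst p)"
    by eventually_elim simp
  then show "AE l in train_marginal \<mu>. 0 \<le> g l"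
    unfolding train_marginal_def by (subst AE_distr_iff) simp_all
qed

text \<open>This is the comparison of I* / s in cross-multiplied form: the overlap densities
  \<open>g1\<close> and \<open>g2\<close> have a monotone ratio, and the common weight
  \<open>h\<close> is decreasing.\<close>

lemma I_star_1_1_mono:
  assumes \<mu>: "ljsd \<mu>1" "ljsd \<mu>2" and le: "ljsd_le \<mu>1 \<mu>2" and \<phi>: "0 < \<phi>" and x: "0 \<le> x"
  shows "I_star \<phi> \<mu>1 1 1 x * test_scale \<mu>2 \<le> test_scale \<mu>1 * I_star \<phi> \<mu>2 1 1 x"
proof -
  let ?N = "train_marginal \<mu>1"
  obtain g1 g2 where eq: "train_marginal \<mu>2 = ?N"
    and g: "overlap_cond_exp \<mu>1 g1" "overlap_cond_exp \<mu>2 g2"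
    and mono: "mono_on (measure_support ?N) (\<lambda>l. ennreal (g1 l) / ennreal (g2 l))"
    using le unfolding ljsd_le_def by metis
  define h where "h l = 1 / (\<phi> + x * l)" for l
  have hm: "h \<in> borel_measurable borel"
    by (simp add: h_def[abs_def])
  have int_h: "integrable \<mu> (\<lambda>p. snd p * h (fst p))" if "ljsd \<mu>" for \<mu>
    using integrable_mult_inverse_affine[OF that \<phi> x ljsdD(5)[OF that]] by (simp add: h_def)
  have int_1: "integrable \<mu> (\<lambda>p. snd p * 1)" if "ljsd \<mu>" for \<mu>
    using ljsdD(5)[OF that] by simp
  note h1 = \<mu>(1) g(1) hm int_h[OF \<mu>(1)]
  note h2 = \<mu>(2) g(2) hm int_h[OF \<mu>(2)]
  \<comment> \<open>The constant weight 1 recovers the test scales as the normalising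
    integrals.\<close>
  note c1 = \<mu>(1) g(1) borel_measurable_const int_1[OF \<mu>(1)]
  note c2 = \<mu>(2) g(2) borel_measurable_const int_1[OF \<mu>(2)]
  have "AE l in ?N. 0 \<le> l"
    unfolding train_marginal_def using measurable_ljsd_fst[OF \<mu>(1)] ljsdD(2)[OF \<mu>(1)]
    by (subst AE_distr_iff) simp_all
  moreover have "AE l in ?N. l \<in> measure_support ?N"
    by (rule AE_in_measure_support) (simp add: train_marginal_def)
  moreover note overlap_cond_exp_nonneg[OF c1] overlap_cond_exp_nonneg[OF c2, unfolded eq]
  \<comment> \<open>Nonnegative l makes \<open>h\<close> decreasing. Points with a negative
    \<open>g1\<close> or \<open>g2\<close> must go, since \<open>ennreal\<close> would truncate the
    value to zero.\<close>
  ultimately have S: "AE l in ?N. l \<in> {l\<in>measure_support ?N. 0 \<le> l \<and> 0 \<le> g1 l \<and> 0 \<le> g2 l}"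
    by eventually_elim simp
  have "(\<integral>l. g1 l * h l \<partial>?N) * (\<integral>l. g2 l \<partial>?N) \<le> (\<integral>l. g1 l \<partial>?N) * (\<integral>l. g2 l * h l \<partial>?N)"
  proof (rule integral_mult_le_of_monotone_ratio[OF _ _ _ _ S])
    show "integrable ?N g1" "integrable ?N g2"
      "integrable ?N (\<lambda>l. g1 l * h l)" "integrable ?N (\<lambda>l. g2 l * h l)"
      using integrable_overlap_cond_exp[OF c1] integrable_overlap_cond_exp[OF c2]
        integrable_overlap_cond_exp[OF h1] integrable_overlap_cond_exp[OF h2]
      by (simp_all add: eq)
    show "h m \<le> h l"
      if "l \<in> {l\<in>measure_support ?N. 0 \<le> l \<and> 0 \<le> g1 l \<and> 0 \<le> g2 l}" "l \<le> m" for l m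
    proof -
      have "x * l \<le> x * m"
        using that(2) x by (rule mult_left_mono)
      moreover have "0 < \<phi> + x * l"
        using that(1) \<phi> x by (simp add: add_pos_nonneg)
      ultimately show ?thesis
        unfolding h_def by (intro frac_le) simp_all
    qed
    show "g1 l * g2 m \<le> g1 m * g2 l"
      if "l \<in> {l\<in>measure_support ?N. 0 \<le> l \<and> 0 \<le> g1 l \<and> 0 \<le> g2 l}"
        "m \<in> {l\<in>measure_support ?N. 0 \<le> l \<and> 0 \<le> g1 l \<and> 0 \<le> g2 l}" "l \<le> m" for l m
      using that mono_onD[OF mono]
      by (intro ennreal_ratio_le_imp_cross_mult_le) auto
  qed
  then have "(\<integral>p. snd p * h (fst p) \<partial>\<mu>1) * test_scale \<mu>2
      \<le> test_scale \<mu>1 * (\<integral>p. snd p * h (fst p) \<partial>\<mu>2)"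
    using integral_overlap_cond_exp[OF c1] integral_overlap_cond_exp[OF c2]
      integral_overlap_cond_exp[OF h1] integral_overlap_cond_exp[OF h2]
    by (simp add: eq test_scale_def)
  then have "\<phi> * ((\<integral>p. snd p * h (fst p) \<partial>\<mu>1) * test_scale \<mu>2)
      \<le> \<phi> * (test_scale \<mu>1 * (\<integral>p. snd p * h (fst p) \<partial>\<mu>2))"
    using \<phi> by (intro mult_left_mono) auto
  moreover have "I_star \<phi> \<mu> 1 1 x = \<phi> * (\<integral>p. snd p * h (fst p) \<partial>\<mu>)" for \<mu>
    by (simp add: I_star_def h_def)
  ultimately show ?thesis
    by (simp only: mult_ac)
qed

section \<open>Linearity and the slope\<close>

text \<open>The training \<rho> is common to both \<xi>^2 and cancels; each remaining test \<rho> is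
  multiplied into its bracket, where \<rho> \<omega> = \<eta> - \<zeta>.\<close>

lemma slope_eq:
  assumes \<mu>: "ljsd \<mu>1" "ljsd \<mu>2" and eq: "train_marginal \<mu>1 = train_marginal \<mu>2"
    and \<zeta>: "act_zeta \<sigma> (train_scale \<mu>1) \<noteq> 0"
      "act_zeta \<sigma> (test_scale \<mu>1) \<noteq> 0" "act_zeta \<sigma> (test_scale \<mu>2) \<noteq> 0"
  shows "slope \<phi> \<sigma> \<mu>1 \<mu>2 =
    (act_eta \<sigma> (test_scale \<mu>2) - act_zeta \<sigma> (test_scale \<mu>2)
      + act_rho \<sigma> (test_scale \<mu>2) * I_star \<phi> \<mu>2 1 1 (ridgeless_x \<phi> \<sigma> \<mu>1)) /
    (act_eta \<sigma> (test_scale \<mu>1) - act_zeta \<sigma> (test_scale \<mu>1)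
      + act_rho \<sigma> (test_scale \<mu>1) * I_star \<phi> \<mu>1 1 1 (ridgeless_x \<phi> \<sigma> \<mu>1))"
proof -
  have cancel: "(q / r) / (p / r) * (a / b) = (q * a) / (p * b)" if "r \<noteq> 0" for p q r a b :: real
    using that by simp
  show ?thesis
    unfolding slope_def xi_squared train_scale_cong[OF \<mu> eq, symmetric]
      ridgeless_x_cong[OF \<mu> eq, symmetric]
      act_rho_mult_act_omega[OF \<zeta>(2), symmetric] act_rho_mult_act_omega[OF \<zeta>(3), symmetric]
      distrib_left[symmetric]
    by (rule cancel) (use act_rho_pos[OF \<zeta>(1)] in simp)
qed

theorem proposition5p6:
  fixes \<phi> v :: real and \<sigma> :: "real \<Rightarrow> real" and \<mu>1 \<mu>2 :: "(real \<times> real) measure"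
  assumes "0 < \<phi>" and "0 \<le> v" and "activation \<sigma>"
    and "ljsd \<mu>1" and "ljsd \<mu>2"
    and "train_marginal \<mu>1 = train_marginal \<mu>2"
    and "act_zeta \<sigma> (train_scale \<mu>1) \<noteq> 0"
    and "act_zeta \<sigma> (test_scale \<mu>1) \<noteq> 0"
    and "act_zeta \<sigma> (test_scale \<mu>2) \<noteq> 0"
    and "\<exists>x. ridgeless_root \<phi> \<sigma> \<mu>1 x"
  shows "(\<exists>E0. \<forall>\<psi>\<in>{0<..<\<phi>}.
            test_error \<phi> \<psi> v \<sigma> \<mu>2 = E0 + slope \<phi> \<sigma> \<mu>1 \<mu>2 * test_error \<phi> \<psi> v \<sigma> \<mu>1)
       \<and> 0 \<le> slope \<phi> \<sigma> \<mu>1 \<mu>2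
       \<and> (ljsd_le \<mu>1 \<mu>2
          \<and> 1 \<le> act_zeta \<sigma> (test_scale \<mu>2) / act_zeta \<sigma> (test_scale \<mu>1)
          \<and> act_zeta \<sigma> (test_scale \<mu>2) / act_zeta \<sigma> (test_scale \<mu>1)
              \<le> act_eta \<sigma> (test_scale \<mu>2) / act_eta \<sigma> (test_scale \<mu>1)
          \<longrightarrow> 1 \<le> slope \<phi> \<sigma> \<mu>1 \<mu>2)"
proof -
  note \<phi> = assms(1) and act = assms(3) and \<mu> = assms(4,5) and eq = assms(6) and \<zeta> = assms(7-9)
  define x where "x = ridgeless_x \<phi> \<sigma> \<mu>1"
  define s1 s2 where s: "s1 = test_scale \<mu>1" "s2 = test_scale \<mu>2"
  define J1 J2 where J: "J1 = I_star \<phi> \<mu>1 1 1 x" "J2 = I_star \<phi> \<mu>2 1 1 x"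
  have s_pos: "0 < s1" "0 < s2"
    using ljsdD(7) \<mu> by (auto simp: s)
  note \<zeta>_s = \<zeta>(2,3)[folded s]
  have x_pos: "0 < x"
    unfolding x_def using \<mu> \<phi> act \<zeta>(1) assms(10)
    by (intro ridgeless_x_pos act_omega_nonneg ljsdD(6))
  have J_pos: "0 < J1" "0 < J2"
    using I_star_1_1_pos[OF _ \<phi>] \<mu> x_pos by (auto simp: J)
  have \<omega>: "0 \<le> act_omega \<sigma> s1" "0 \<le> act_omega \<sigma> s2"
    using act_omega_nonneg[OF _ act] s_pos \<zeta>_s by auto
  have \<rho>: "0 < act_rho \<sigma> s1" "0 < act_rho \<sigma> s2" "0 < act_rho \<sigma> (train_scale \<mu>1)"
    using \<zeta>_s \<zeta>(1) act_rho_pos by auto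
  have x2: "ridgeless_x \<phi> \<sigma> \<mu>2 = x" and scale2: "train_scale \<mu>2 = train_scale \<mu>1"
    using ridgeless_x_cong[OF \<mu> eq] train_scale_cong[OF \<mu> eq] by (auto simp: x_def)
  have I2: "I_fun \<phi> \<mu>2 a b y = I_fun \<phi> \<mu>1 a b y" for a b y
    using I_fun_cong[OF \<mu> eq] by simp

  let ?S = "slope \<phi> \<sigma> \<mu>1 \<mu>2"
  let ?D1 = "(xi \<sigma> \<mu>1)\<^sup>2 * (act_omega \<sigma> s1 + J1)" and ?D2 = "(xi \<sigma> \<mu>2)\<^sup>2 * (act_omega \<sigma> s2 + J2)"
  have D: "0 < ?D1" "0 < ?D2"
    using \<rho> \<omega> J_pos by (simp_all add: xi_squared scale2 flip: s)
  have S: "?S = ?D2 / ?D1"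
    by (simp add: slope_def x2 del: One_nat_def flip: x_def s J)

  define K where "K = x * (v + I_fun \<phi> \<mu>1 1 1 x)"
  \<comment> \<open>\<open>R\<close> collects everything free of \<psi>. Its unstarred functionals
    are written with \<open>\<mu>1\<close>, since both measures give the same values.\<close>
  define R where "R \<mu> = bias \<phi> \<sigma> \<mu> + (xi \<sigma> \<mu>)\<^sup>2 * x *
    (1 - x * (act_omega \<sigma> (train_scale \<mu>1) - v) / (1 - x\<^sup>2 * I_fun \<phi> \<mu>1 2 2 x)) * I_star \<phi> \<mu> 2 2 x"
    for \<mu>
  have E: "test_error \<phi> \<psi> v \<sigma> \<mu>1 = R \<mu>1 + \<psi> / (\<phi> - \<psi>) * K * ?D1"
    "test_error \<phi> \<psi> v \<sigma> \<mu>2 = R \<mu>2 + \<psi> / (\<phi> - \<psi>) * K * ?D2" for \<psi>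
    by (simp_all add: test_error_def variance_term_def Let_def R_def K_def x2 scale2 I2 mult_ac
        del: One_nat_def flip: x_def s J)
  \<comment> \<open>The intercept is chosen to cancel the \<psi>-free parts; it remains that
    \<open>?S\<close> times \<open>?D1\<close> is \<open>?D2\<close>.\<close>
  have "test_error \<phi> \<psi> v \<sigma> \<mu>2 = (R \<mu>2 - ?S * R \<mu>1) + ?S * test_error \<phi> \<psi> v \<sigma> \<mu>1" for \<psi>
  proof -
    have "?S * ?D1 = ?D2"
      unfolding S using D(1) by (metis less_irrefl nonzero_eq_divide_eq)
    then have "test_error \<phi> \<psi> v \<sigma> \<mu>2 = R \<mu>2 + \<psi> / (\<phi> - \<psi>) * K * (?S * ?D1)"
      by (simp only: E)
    then show ?thesis
      unfolding E(1) by (simp only: distrib_left mult.left_commute[of ?S])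
  qed
  then have linear: "\<exists>E0. \<forall>\<psi>\<in>{0<..<\<phi>}.
      test_error \<phi> \<psi> v \<sigma> \<mu>2 = E0 + ?S * test_error \<phi> \<psi> v \<sigma> \<mu>1"
    by blast

  have "1 \<le> ?S" if le: "ljsd_le \<mu>1 \<mu>2"
    and \<zeta>_le: "1 \<le> act_zeta \<sigma> s2 / act_zeta \<sigma> s1"
    and \<eta>_le: "act_zeta \<sigma> s2 / act_zeta \<sigma> s1 \<le> act_eta \<sigma> s2 / act_eta \<sigma> s1"
  proof -
    let ?q = "act_zeta \<sigma> s2 / act_zeta \<sigma> s1"
    have \<zeta>1: "0 < act_zeta \<sigma> s1" and \<eta>1: "act_zeta \<sigma> s1 \<le> act_eta \<sigma> s1"
      using act_zeta_pos[OF s_pos(1) \<zeta>_s(1)] act_zeta_le_act_eta[OF s_pos(1) act] by auto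
    \<comment> \<open>With q = \<zeta>2 / \<zeta>1 \<ge> 1 the chain is \<eta>1 - \<zeta>1 \<le> q
      (\<eta>1 - \<zeta>1) = q \<eta>1 - \<zeta>2 \<le> \<eta>2 - \<zeta>2. The first step needs
      \<zeta>1 \<le> \<eta>1, the last q \<le> \<eta>2 / \<eta>1.\<close>
    have "1 * (act_eta \<sigma> s1 - act_zeta \<sigma> s1) \<le> ?q * (act_eta \<sigma> s1 - act_zeta \<sigma> s1)"
      using \<zeta>_le \<eta>1 by (intro mult_right_mono) auto
    also have "\<dots> = ?q * act_eta \<sigma> s1 - act_zeta \<sigma> s2"
      using \<zeta>1 by (simp add: right_diff_distrib)
    also have "\<dots> \<le> act_eta \<sigma> s2 - act_zeta \<sigma> s2"
      using \<eta>_le \<zeta>1 \<eta>1 by (simp add: pos_le_divide_eq)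
    finally have \<eta>\<zeta>: "act_eta \<sigma> s1 - act_zeta \<sigma> s1 \<le> act_eta \<sigma> s2 - act_zeta \<sigma> s2"
      by simp
    have \<rho>\<zeta>: "act_rho \<sigma> s1 = act_zeta \<sigma> s1 / s1" "act_rho \<sigma> s2 = act_zeta \<sigma> s2 / s2"
      using s_pos by (simp_all add: act_zeta_def)
    have "J1 * s2 \<le> s1 * J2"
      using I_star_1_1_mono[OF \<mu> le \<phi>] x_pos by (simp add: s J)
    then have "J1 / s1 \<le> J2 / s2"
      using s_pos by (simp add: field_simps)
    then have "act_zeta \<sigma> s1 * (J1 / s1) \<le> act_zeta \<sigma> s2 * (J2 / s2)"
      using \<zeta>1 \<zeta>_le J_pos s_pos by (intro mult_mono) (auto simp: pos_le_divide_eq)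
    then have "act_rho \<sigma> s1 * J1 \<le> act_rho \<sigma> s2 * J2"
      by (simp add: \<rho>\<zeta>)
    \<comment> \<open>Numerator and denominator are now compared summand by summand; the denominator
      is positive because \<rho>1 and \<open>J1\<close> are.\<close>
    with \<eta>\<zeta> \<rho>(1) J_pos(1) \<eta>1 show ?thesis
      unfolding slope_eq[OF \<mu> eq \<zeta>] x_def[symmetric] s[symmetric] J[symmetric]
      by (subst pos_le_divide_eq) (auto intro: add_nonneg_pos)
  qed
  moreover have "0 \<le> ?S"
    using D unfolding S by simp
  ultimately show ?thesis
    using linear unfolding s by blast
qed

end
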